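(* Let $\mathbb K=\mathbb R$ or $\mathbb K=\mathbb C$ and let $n\ge 1$ be an integer. The semigroup $M_n(\mathbb K)$ of all square matrices of order $n$ over $\mathbb K$ under matrix multiplication, equipped with the usual topology, is not a topological regular semigroup.
   Context: An inverse of an element $x$ of a semigroup $S$ is an element $y\in S$ with $x=xyx$ and $y=yxy$; $V(x)$ denotes the set of all inverses of $x$. A semigroup is regular if for every $x \in S$ there is $y\in S$ with $x=xyx$ (equivalently, $V(x)\ne\emptyset$ for every $x$). A topological semigroup is a semigroup $S$ equipped with a topology such that the product map $S\times S\to S$ is continuous, where $S\times S$ has the product topology. For a regular semigroup $S$, $V$ is viewed as a multiple map (set-valued map) from $S$ to $S$, $x\mapsto V(x)$. For $A\subseteq S$ put $V(A)=\{y\in S: y\in V(x)\text{ for some }x\in A\}$. The multiple map $V$ is said to be open if $V(A)$ is open in $S$ for every open set $A\subseteq S$. A topological regular semigroup is a topological semigroup $S$ that is also a regular semigroup and for which the multiple map $V:S\to S$ is open. The usual topology on $M_n(\mathbb K)$ is the Euclidean topology obtained by identifying $M_n(\mathbb K)$ with $\mathbb K^{n^2}$. *)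

theory Defs
  imports "HOL-Analysis.Analysis"
begin

definition semigroup_inverses :: "('a \<Rightarrow> 'a \<Rightarrow> 'a) \<Rightarrow> 'a \<Rightarrow> 'a set"
  where "semigroup_inverses f x = {y. x = f (f x y) x \<and> y = f (f y x) y}"

definition semigroup_inverses_of_set :: "('a \<Rightarrow> 'a \<Rightarrow> 'a) \<Rightarrow> 'a set \<Rightarrow> 'a set"
  where "semigroup_inverses_of_set f A = {y. \<exists>x\<in>A. y \<in> semigroup_inverses f x}"

locale regular_semigroup = semigroup f
  for f :: "'a \<Rightarrow> 'a \<Rightarrow> 'a" +
  assumes regular: "\<exists>y. x = f (f x y) x"

locale topological_semigroup = semigroup f
  for f :: "'a::topological_space \<Rightarrow> 'a \<Rightarrow> 'a" +
  assumes continuous_mult: "continuous_on UNIV (\<lambda>(x, y). f x y)"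

locale topological_regular_semigroup = topological_semigroup f + regular_semigroup f
  for f :: "'a::topological_space \<Rightarrow> 'a \<Rightarrow> 'a" +
  assumes open_inverses: "open A \<Longrightarrow> open (semigroup_inverses_of_set f A)"

end

theory Submission
  imports Defs
begin

text \<open>The zero matrix is its own inverse, so the set of inverses of the unit ball contains 0. It does
  not contain the scalar matrices \<open>t I\<close> with \<open>0 < t < 1\<close>, whose unique inverse \<open>t\<^sup>-\<^sup>1 I\<close> has norm
  greater than 1; hence it is not a neighbourhood of 0.\<close>

lemma scaleR_mat_1_mult:
  fixes X :: "'a::real_normed_field ^ 'n ^ 'n"
  shows "(t *\<^sub>R mat 1) ** X = t *\<^sub>R X"
  by (simp add: matrix_matrix_mult_def mat_def vec_eq_iff if_distrib if_distribR cong: if_cong)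

lemma mult_scaleR_mat_1:
  fixes X :: "'a::real_normed_field ^ 'n ^ 'n"
  shows "X ** (t *\<^sub>R mat 1) = t *\<^sub>R X"
  by (simp add: matrix_matrix_mult_def mat_def vec_eq_iff if_distrib if_distribR cong: if_cong)

text \<open>With \<open>y\<close> the scalar matrix, the equation \<open>y = y ** X ** y\<close>
  turns into t I = t^2 X. Cancelling t leaves I = t X, so every diagonal entry of X has norm
  1/t.\<close>

lemma norm_inverse_scalar_matrix:
  fixes X :: "'a::real_normed_field ^ 'n ^ 'n"
  assumes "0 < t" and "t *\<^sub>R mat 1 \<in> semigroup_inverses (**) X"
  shows "1 / t \<le> norm X"
proof -
  \<comment> \<open>Only some index is needed; one exists because the type \<open>'n\<close> is
    nonempty, which encodes n \<ge> 1.\<close>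
  obtain i :: 'n where True by simp
  have "t *\<^sub>R mat 1 = t *\<^sub>R t *\<^sub>R X"
    using assms(2) by (simp add: semigroup_inverses_def scaleR_mat_1_mult mult_scaleR_mat_1)
  then have "(mat 1 :: 'a ^ 'n ^ 'n) = t *\<^sub>R X"
    using \<open>0 < t\<close> by (simp only: scaleR_cancel_left) simp
  then have "(mat 1 :: 'a ^ 'n ^ 'n) $ i $ i = (t *\<^sub>R X) $ i $ i"
    by simp
  then have "norm (1::'a) = norm (t *\<^sub>R X $ i $ i)"
    by (simp add: mat_def)
  then have "1 = t * norm (X $ i $ i)"
    using \<open>0 < t\<close> by simp
  \<comment> \<open>The norm of an entry is at most that of its row, which is at most that of the
    matrix.\<close>
  also have "\<dots> \<le> t * norm X"
    using \<open>0 < t\<close> by (intro mult_left_mono order.trans[OF Finite_Cartesian_Product.norm_nth_le Finite_Cartesian_Product.norm_nth_le]) auto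
  finally show ?thesis
    using \<open>0 < t\<close> by (simp add: field_simps)
qed

text \<open>Stated over any real normed field, so that the real and the complex case are both
  instances.\<close>

lemma not_topological_regular_semigroup_matrix:
  "\<not> topological_regular_semigroup
      ((**) :: 'a::real_normed_field ^ 'n ^ 'n \<Rightarrow> 'a ^ 'n ^ 'n \<Rightarrow> 'a ^ 'n ^ 'n)"
proof
  assume "topological_regular_semigroup ((**) :: 'a ^ 'n ^ 'n \<Rightarrow> 'a ^ 'n ^ 'n \<Rightarrow> 'a ^ 'n ^ 'n)"
  then interpret topological_regular_semigroup
    "(**) :: 'a ^ 'n ^ 'n \<Rightarrow> 'a ^ 'n ^ 'n \<Rightarrow> 'a ^ 'n ^ 'n" .
  define V where "V = semigroup_inverses_of_set (**) (ball (0 :: 'a ^ 'n ^ 'n) 1)"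
  have "open V"
    unfolding V_def by (rule open_inverses) simp
  moreover have "0 \<in> V"
    by (auto simp: V_def semigroup_inverses_of_set_def semigroup_inverses_def intro!: bexI[of _ 0])
  \<comment> \<open>The scalar matrices approach 0 along t > 0, so they eventually enter the open
    set \<open>V\<close>. The limit is kept as a multiple of \<open>mat 1\<close> to fit the
    continuity rules.\<close>
  moreover have "((\<lambda>t. t *\<^sub>R (mat 1 :: 'a ^ 'n ^ 'n)) \<longlongrightarrow> 0 *\<^sub>R mat 1) (at_right 0)"
    by (intro tendsto_intros)
  ultimately have "\<forall>\<^sub>F t in at_right 0. t *\<^sub>R (mat 1 :: 'a ^ 'n ^ 'n) \<in> V"
    by (simp add: topological_tendstoD)
  moreover have "\<forall>\<^sub>F t in at_right 0. t \<in> {0<..<1::real}"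
    by (rule eventually_at_right_real) simp
  \<comment> \<open>This is absurd because \<open>at_right 0\<close> is a nontrivial filter on the
    reals.\<close>
  ultimately have "\<forall>\<^sub>F t in at_right (0::real). False"
  proof eventually_elim
    case (elim t)
    then obtain X :: "'a ^ 'n ^ 'n" where "norm X < 1" "t *\<^sub>R mat 1 \<in> semigroup_inverses (**) X"
      by (auto simp: V_def semigroup_inverses_of_set_def)
    moreover have "0 < t" "1 < 1 / t"
      using elim by simp_all
    ultimately show False
      using norm_inverse_scalar_matrix[of t X] by linarith
  qed
  then show False
    by simp
qed

theorem corollary1:
  shows "\<not> topological_regular_semigroup ((**) :: real ^ 'n ^ 'n \<Rightarrow> real ^ 'n ^ 'n \<Rightarrow> real ^ 'n ^ 'n)
       \<and> \<not> topological_regular_semigroup ((**) :: complex ^ 'n ^ 'n \<Rightarrow> complex ^ 'n ^ 'n \<Rightarrow> complex ^ 'n ^ 'n)"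
  by (intro conjI not_topological_regular_semigroup_matrix)

end
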